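(* Let $K$ be a field, $R=K[x_1,\dots,x_n]$, and let $I\subset R$ be a (nonzero proper) monomial ideal without embedded associated primes with minimal irreducible decomposition $I=\mathfrak{q}_1\cap\cdots\cap\mathfrak{q}_r$, where $\mathfrak{q}_j=\langle x_i^{w_{j,i}} : i\in A_j\rangle$ with $A_j\subset[n]$ and $w_{j,i}$ positive integers. Let $\mathcal{H}_I$ be the hypergraph on $[n]$ with edge set $\{A_1,\dots,A_r\}$. Suppose $\mathcal{H}_I$ is a whiskered hypergraph with whiskers $A_{j_1},\dots,A_{j_t}$ attached to the vertices $i_1,\dots,i_t$, respectively. Assume that: (i) $w_{j_k,i}\ge w_{j_k,i_k}$ for all $1\le k\le t$ and all $i\in A_{j_k}$; and (ii) for each $j\in[r]$ with $j\ne j_1,\dots,j_t$, there exists $1\le k\le t$ with $i_k\in A_j$ such that $w_{j,i_k}\le w_{j_k,i_k}$. If $h$ is the big-height of $I$, then $$\hat{\alpha}(I)\;\ge\;\frac{\alpha(I)+h-1}{h}.$$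
   Context: $[n]=\{1,\dots,n\}$. Minimal irreducible decomposition: $I=\mathfrak{q}_1\cap\cdots\cap\mathfrak{q}_r$ where each $\mathfrak{q}_j$ is an irreducible monomial ideal (i.e. of the form $\langle x_i^{w_{j,i}} : i\in A_j\rangle$ with $\emptyset\ne A_j\subset[n]$, $w_{j,i}\ge1$), the radicals $\mathfrak{p}_j=\sqrt{\mathfrak{q}_j}=\langle x_i: i\in A_j\rangle$ are pairwise distinct, and the intersection is irredundant; thus $\mathrm{Ass}(I)=\{\mathfrak{p}_1,\dots,\mathfrak{p}_r\}$. It is assumed that $I$ admits such a decomposition. An embedded prime is an associated prime properly containing another associated prime; having none means $A_j\not\subset A_k$ for $j\neq k$. Whiskered hypergraph: a hypergraph on $[n]$ with edge set $\{A_1,\dots,A_r\}$ is whiskered, with whiskers $A_{j_1},\dots,A_{j_t}$ attached to the vertices $i_1,\dots,i_t$ respectively, if the edges $A_{j_1},\dots,A_{j_t}$ are mutually disjoint and the set $V_1=\{i_1,\dots,i_t\}\subset[n]$ satisfies: $A_j\subset V_1$ for all $j\neq j_1,\dots,j_t$; and $V_1\cap A_{j_k}=\{i_k\}$ for all $1\le k\le t$. The big-height of $I$ is the maximum of the heights of its associated primes. For $s\ge1$, $I^{(s)}=\bigcap_{\mathfrak{p}\in \mathrm{Ass}(I)}(I^sR_{\mathfrak{p}}\cap R)$. For a nonzero homogeneous ideal $L$, $\alpha(L)=\min\{d : L_d\neq 0\}$. The Waldschmidt constant is $\hat{\alpha}(I)=\lim_{s\to\infty}\alpha(I^{(s)})/s$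 (the limit exists). *)

theory Defs
  imports
    Complex_Main
    "HOL-Library.Poly_Mapping"
    "HOL-Library.Extended_Nat"
    "HOL-Library.Disjoint_Sets"
    "HOL-Computational_Algebra.Fraction_Field"
    "HOL-Algebra.Ideal_Product"
    "HOL-Algebra.Algebraic_Closure_Type"
begin

text \<open>
  The polynomial ring \<open>K[x\<^sub>1,\<dots>,x\<^sub>n]\<close> is the monoid algebra of the exponent vectors: the variables are
  indexed by a finite linearly ordered type \<open>'n\<close> with \<open>n\<close> elements, which plays the role of
  \<open>[n]\<close>, and the coefficients form a field \<open>'k\<close>. The order on \<open>'n\<close> is used only because the library
  proves the monoid algebra to be an integral domain for linearly ordered monoids of exponents.
\<close>

type_synonym ('n, 'k) mpoly = "('n \<Rightarrow>\<^sub>0 nat) \<Rightarrow>\<^sub>0 'k"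

abbreviation ring_of :: "'a::comm_ring_1 itself \<Rightarrow> 'a ring" where
  "ring_of _ \<equiv> ring_of_type_algebra"

abbreviation ideal_gen :: "'a::comm_ring_1 set \<Rightarrow> 'a set" where
  "ideal_gen S \<equiv> Idl\<^bsub>ring_of TYPE('a)\<^esub> S"

abbreviation is_prime_ideal :: "'a::comm_ring_1 set \<Rightarrow> bool" where
  "is_prime_ideal P \<equiv> primeideal P (ring_of TYPE('a))"

abbreviation ideal_power :: "'a::comm_ring_1 set \<Rightarrow> nat \<Rightarrow> 'a set" where
  "ideal_power I s \<equiv> I [^]\<^bsub>ideals_set (ring_of TYPE('a))\<^esub> s"


subsection \<open>Commutative algebra\<close>

definition radical :: "'a::comm_ring_1 set \<Rightarrow> 'a set" where
  "radical I = {f. \<exists>m::nat. f ^ m \<in> I}"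

definition Ass :: "'a::comm_ring_1 set \<Rightarrow> 'a set set" where
  "Ass I = {P. is_prime_ideal P \<and> (\<exists>f. P = {g. g * f \<in> I})}"

definition no_embedded_primes :: "'a::comm_ring_1 set \<Rightarrow> bool" where
  "no_embedded_primes I \<longleftrightarrow> \<not> (\<exists>P\<in>Ass I. \<exists>Q\<in>Ass I. Q \<subset> P)"

text \<open>The height of a prime ideal \<open>P\<close> is the supremum of the lengths \<open>l\<close> of chains \<open>P\<^sub>0 \<subset> \<dots> \<subset> P\<^sub>l = P\<close> of prime ideals.\<close>

definition height :: "'a::comm_ring_1 set \<Rightarrow> enat" where
  "height P = (SUP l \<in> {l. \<exists>C :: nat \<Rightarrow> 'a set. (\<forall>i\<le>l. is_prime_ideal (C i)) \<and>
      (\<forall>i<l. C i \<subset> C (Suc i)) \<and> C l = P}. enat l)"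

definition big_height :: "'a::comm_ring_1 set \<Rightarrow> enat" where
  "big_height I = (SUP P \<in> Ass I. height P)"

text \<open>The local ring \<open>R\<^sub>P\<close> of a domain \<open>R\<close> at a prime ideal \<open>P\<close>, as a subring of the fraction field.\<close>

definition local_ring :: "'a::idom set \<Rightarrow> 'a fract ring" where
  "local_ring P = (ring_of TYPE('a fract))\<lparr>carrier := {Fract a b | a b. b \<notin> P}\<rparr>"

definition extend_local :: "'a::idom set \<Rightarrow> 'a set \<Rightarrow> 'a fract set" where
  "extend_local P J = Idl\<^bsub>local_ring P\<^esub> ((\<lambda>f. Fract f 1) ` J)"

text \<open>\<open>R\<close> is embedded into its fraction field by \<open>f \<mapsto> f/1\<close>; thus the set under the intersection
  is \<open>I\<^sup>sR\<^sub>P \<inter> R\<close>.\<close>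

definition symbolic_power :: "'a::idom set \<Rightarrow> nat \<Rightarrow> 'a set" where
  "symbolic_power I s = (\<Inter>P\<in>Ass I. {f. Fract f 1 \<in> extend_local P (ideal_power I s)})"


subsection \<open>Initial degree and Waldschmidt constant\<close>

definition mdeg :: "('n::finite \<Rightarrow>\<^sub>0 nat) \<Rightarrow> nat" where
  "mdeg m = (\<Sum>i\<in>UNIV. Poly_Mapping.lookup m i)"

definition homog_part :: "('n::finite, 'k::field) mpoly set \<Rightarrow> nat \<Rightarrow> ('n, 'k) mpoly set" where
  "homog_part L d = {f \<in> L. \<forall>m\<in>Poly_Mapping.keys f. mdeg m = d}"

definition alpha :: "('n::finite, 'k::field) mpoly set \<Rightarrow> nat" where
  "alpha L = (LEAST d. homog_part L d \<noteq> {0})"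

definition waldschmidt :: "('n::{finite,linorder}, 'k::field) mpoly set \<Rightarrow> real" where
  "waldschmidt I = lim (\<lambda>s. real (alpha (symbolic_power I s)) / real s)"


subsection \<open>Monomial ideals and irreducible decompositions\<close>

definition monomial_ideal :: "('n, 'k::field) mpoly set \<Rightarrow> bool" where
  "monomial_ideal I \<longleftrightarrow> (\<exists>M :: ('n \<Rightarrow>\<^sub>0 nat) set. I = ideal_gen ((\<lambda>m. Poly_Mapping.single m 1) ` M))"

definition Var :: "'n \<Rightarrow> ('n, 'k::field) mpoly" where
  "Var i = Poly_Mapping.single (Poly_Mapping.single i 1) 1"

text \<open>The ideal generated by the powers \<open>x\<^sub>i ^ w i\<close> for \<open>i \<in> A\<close>.\<close>

definition irred_ideal :: "'n set \<Rightarrow> ('n \<Rightarrow> nat) \<Rightarrow> ('n, 'k::field) mpoly set" where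
  "irred_ideal A w = ideal_gen ((\<lambda>i. Var i ^ w i) ` A)"

definition min_irred_decomp ::
  "('n, 'k::field) mpoly set \<Rightarrow> nat \<Rightarrow> (nat \<Rightarrow> 'n set) \<Rightarrow> (nat \<Rightarrow> 'n \<Rightarrow> nat) \<Rightarrow> bool" where
  "min_irred_decomp I r A w \<longleftrightarrow>
     (\<forall>j\<in>{1..r}. A j \<noteq> {} \<and> (\<forall>i\<in>A j. w j i \<ge> 1)) \<and>
     I = (\<Inter>j\<in>{1..r}. irred_ideal (A j) (w j)) \<and>
     inj_on (\<lambda>j. radical (irred_ideal (A j) (w j) :: ('n, 'k) mpoly set)) {1..r} \<and>
     (\<forall>j\<in>{1..r}. I \<noteq> (\<Inter>k\<in>{1..r} - {j}. irred_ideal (A k) (w k)))"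


subsection \<open>Whiskered hypergraphs\<close>

text \<open>The hypergraph with edge set \<open>E\<close> is whiskered, with whiskers \<open>W 1, \<dots>, W t\<close> attached to the
  vertices \<open>v 1, \<dots>, v t\<close>.\<close>

definition whiskered :: "'n set set \<Rightarrow> nat \<Rightarrow> (nat \<Rightarrow> 'n set) \<Rightarrow> (nat \<Rightarrow> 'n) \<Rightarrow> bool" where
  "whiskered E t W v \<longleftrightarrow>
     W ` {1..t} \<subseteq> E \<and>
     disjoint_family_on W {1..t} \<and>
     (\<forall>e \<in> E - W ` {1..t}. e \<subseteq> v ` {1..t}) \<and>
     (\<forall>k\<in>{1..t}. v ` {1..t} \<inter> W k = {v k})"

end

theory Submission
  imports Defs
begin

text \<open>
  In fact \<open>\<alpha>(I)\<close> itself is a lower bound for the Waldschmidt constant, and \<open>(\<alpha> + h - 1)/h \<le> \<alpha>\<close> as soon as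
  \<open>\<alpha> \<ge> 1\<close>. Put \<open>c\<^sub>k\<close> for the exponent of \<open>x\<^bsub>i\<^sub>k\<^esub>\<close> in the component of the \<open>k\<close>-th whisker. By (ii) the
  monomial with exponent \<open>c\<^sub>k\<close> at \<open>i\<^sub>k\<close> lies in every component, so \<open>\<alpha>(I) \<le> \<Sum>\<^sub>k c\<^sub>k\<close>. Conversely, the weight
  \<open>\<Sum>\<^bsub>i \<in> A\<^sub>j\<^esub> u\<^sub>i / w\<^bsub>j,i\<^esub>\<close> of an exponent \<open>u\<close> is at least \<open>s\<close> on \<open>q\<^sub>j\<^sup>s\<close>; being the minimum over the
  monomials of an additive function, it is a valuation that vanishes outside \<open>p\<^sub>j\<close>, so the bound persists on
  \<open>q\<^sub>j\<^sup>s R\<^sub>p \<inter> R\<close> and hence on the symbolic power. By (i) each whisker thus carries degree at least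
  \<open>s c\<^sub>k\<close>, and the whiskers are disjoint. Subadditivity of \<open>\<alpha>\<close> on symbolic powers makes the limit exist.
\<close>

subsection \<open>Ideals, localization and symbolic powers\<close>

text \<open>Closure under negation comes for free: the additive inverse is multiplication by the
  inverse of \<open>\<one>\<close>. Both absorption laws are asked for, so that the criterion serves
  any ring, in particular \<open>local_ring P\<close>.\<close>

lemma (in ring) idealI_closed:
  assumes sub: "J \<subseteq> carrier R" and zero: "\<zero> \<in> J"
    and add: "\<And>a b. a \<in> J \<Longrightarrow> b \<in> J \<Longrightarrow> a \<oplus> b \<in> J"
    and l: "\<And>a r. a \<in> J \<Longrightarrow> r \<in> carrier R \<Longrightarrow> r \<otimes> a \<in> J"
    and r: "\<And>a r. a \<in> J \<Longrightarrow> r \<in> carrier R \<Longrightarrow> a \<otimes> r \<in> J"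
  shows "ideal J R"
proof (rule idealI)
  show "ring R" by (rule ring_axioms)
  show "subgroup J (add_monoid R)"
  proof (rule add.subgroupI)
    show "\<ominus> a \<in> J" if "a \<in> J" for a
    proof -
      have "a \<in> carrier R" using that sub by auto
      then have "\<ominus> a = (\<ominus> \<one>) \<otimes> a" by (simp add: l_minus)
      then show ?thesis using l[OF that, of "\<ominus> \<one>"] by simp
    qed
  qed (use assms in auto)
qed (use l r in auto)

lemma ring_of_simps [simp]:
  "carrier (ring_of TYPE('a::comm_ring_1)) = UNIV"
  "a \<otimes>\<^bsub>ring_of TYPE('a)\<^esub> b = a * b"
  "a \<oplus>\<^bsub>ring_of TYPE('a)\<^esub> b = a + b"
  "\<zero>\<^bsub>ring_of TYPE('a)\<^esub> = 0"
  "\<one>\<^bsub>ring_of TYPE('a)\<^esub> = 1"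
  by (simp_all add: ring_of_type_algebra_def)

lemma ideal_ring_of_iff:
  fixes J :: "'a::comm_ring_1 set"
  shows "ideal J (ring_of TYPE('a)) \<longleftrightarrow>
    0 \<in> J \<and> (\<forall>a\<in>J. \<forall>b\<in>J. a + b \<in> J) \<and> (\<forall>a\<in>J. \<forall>r. r * a \<in> J)"
proof
  assume "ideal J (ring_of TYPE('a))"
  then interpret ideal J "ring_of TYPE('a)" .
  show "0 \<in> J \<and> (\<forall>a\<in>J. \<forall>b\<in>J. a + b \<in> J) \<and> (\<forall>a\<in>J. \<forall>r. r * a \<in> J)"
    using additive_subgroup.zero_closed[OF additive_subgroup_axioms]
      additive_subgroup.a_closed[OF additive_subgroup_axioms] I_l_closed by auto
next
  interpret ring "ring_of TYPE('a)" by (rule ring_from_type_algebra)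
  assume "0 \<in> J \<and> (\<forall>a\<in>J. \<forall>b\<in>J. a + b \<in> J) \<and> (\<forall>a\<in>J. \<forall>r. r * a \<in> J)"
  then show "ideal J (ring_of TYPE('a))"
    by (intro idealI_closed) (auto simp: mult.commute)
qed

lemma is_prime_idealI:
  fixes P :: "'a::comm_ring_1 set"
  assumes "ideal P (ring_of TYPE('a))" and "P \<noteq> UNIV"
    and "\<And>a b. a * b \<in> P \<Longrightarrow> a \<in> P \<or> b \<in> P"
  shows "is_prime_ideal P"
  by (rule primeidealI) (use assms in \<open>auto intro: cring_from_type_algebra\<close>)

lemma is_prime_idealD:
  fixes P :: "'a::comm_ring_1 set"
  assumes "is_prime_ideal P"
  shows "0 \<in> P" and "1 \<notin> P" and "\<And>a b. a * b \<in> P \<Longrightarrow> a \<in> P \<or> b \<in> P"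
proof -
  interpret primeideal P "ring_of TYPE('a)" by (rule assms)
  show "0 \<in> P" using additive_subgroup.zero_closed[OF additive_subgroup_axioms] by simp
  show "1 \<notin> P" using one_imp_carrier I_notcarr by auto
  show "\<And>a b. a * b \<in> P \<Longrightarrow> a \<in> P \<or> b \<in> P" using I_prime by auto
qed

lemma ideal_gen_ideal: "ideal (ideal_gen S) (ring_of TYPE('a::comm_ring_1))"
proof -
  interpret ring "ring_of TYPE('a)" by (rule ring_from_type_algebra)
  show ?thesis by (rule genideal_ideal) simp
qed

lemma ideal_gen_self: "S \<subseteq> ideal_gen S"
  by (auto simp: genideal_def)

lemma ideal_gen_minimal:
  fixes J :: "'a::comm_ring_1 set"
  assumes "ideal J (ring_of TYPE('a))" and "S \<subseteq> J"
  shows "ideal_gen S \<subseteq> J"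
  using assms by (auto simp: genideal_def)

lemma ideals_set_simps [simp]:
  "carrier (ideals_set R) = {I. ideal I R}"
  "I \<otimes>\<^bsub>ideals_set R\<^esub> J = ideal_prod R I J"
  "\<one>\<^bsub>ideals_set R\<^esub> = carrier R"
  by (simp_all add: ideals_set_def)

context
  fixes I :: "'a::comm_ring_1 set"
  assumes I: "ideal I (ring_of TYPE('a))"
begin

interpretation R: cring "ring_of TYPE('a)" by (rule cring_from_type_algebra)
interpretation M: comm_monoid "ideals_set (ring_of TYPE('a))" by (rule R.ideals_set_is_comm_monoid)

lemma ideal_power_ideal: "ideal (ideal_power I s) (ring_of TYPE('a))"
  using M.nat_pow_closed[of I s] I by simp

lemma ideal_power_mult:
  assumes "f \<in> ideal_power I s" and "g \<in> ideal_power I u"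
  shows "f * g \<in> ideal_power I (s + u)"
proof -
  have "f * g \<in> ideal_prod (ring_of TYPE('a)) (ideal_power I s) (ideal_power I u)"
    using ideal_prod.prod[OF assms, of "ring_of TYPE('a)"] by simp
  also have "\<dots> = ideal_power I (s + u)"
    using M.nat_pow_mult[of I s u] I by simp
  finally show ?thesis .
qed

lemma power_in_ideal_power: "f \<in> I \<Longrightarrow> f ^ s \<in> ideal_power I s"
proof (induction s)
  case (Suc s)
  then have "f ^ s * f \<in> ideal_prod (ring_of TYPE('a)) (ideal_power I s) I"
    using ideal_prod.prod[of "f ^ s" _ f I "ring_of TYPE('a)"] by simp
  then show ?case by (simp add: mult.commute)
qed simp

text \<open>Induction principle for powers: a multiplicative filtration \<open>V\<close> that
  contains \<open>I\<close> in degree 1 contains each power in the matching degree. The zeroth power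
  is the whole ring, whence the condition on \<open>V 0\<close>. It is applied with
  \<open>V s\<close> the polynomials of weight at least \<open>s\<close>.\<close>

lemma ideal_power_subset:
  assumes V0: "V 0 = UNIV" and "I \<subseteq> V 1"
    and add: "\<And>s f g. f \<in> V s \<Longrightarrow> g \<in> V s \<Longrightarrow> f + g \<in> V s"
    and mult: "\<And>s u f g. f \<in> V s \<Longrightarrow> g \<in> V u \<Longrightarrow> f * g \<in> V (s + u)"
  shows "ideal_power I s \<subseteq> V s"
proof (induction s)
  case (Suc s)
  have "f \<in> V (Suc s)" if "f \<in> ideal_prod (ring_of TYPE('a)) (ideal_power I s) I" for f
    using that
  proof induction
    case (prod i j)
    then show ?case using Suc \<open>I \<subseteq> V 1\<close> mult[of i s j 1] by auto
  next
    case (sum a b)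
    then show ?case using add by auto
  qed
  then show ?case by auto
qed (simp add: V0)

end

section \<open>Localization at a prime and symbolic powers\<close>

lemma local_ring_ring:
  fixes P :: "'a::idom set"
  assumes P: "is_prime_ideal P"
  shows "ring (local_ring P)"
proof -
  note D = is_prime_idealD[OF P]
  interpret ring "ring_of TYPE('a fract)" by (rule ring_from_type_algebra)
  have neg: "\<ominus>\<^bsub>ring_of TYPE('a fract)\<^esub> x = - x" for x
    by (rule minus_equality) auto
  have "subring {Fract a b | a b. b \<notin> P} (ring_of TYPE('a fract))"
  proof (rule subringI)
    show "\<one>\<^bsub>ring_of TYPE('a fract)\<^esub> \<in> {Fract a b | a b. b \<notin> P}"
      using D(2) by (auto simp: One_fract_def)
  next
    fix x y :: "'a fract"
    assume "x \<in> {Fract a b | a b. b \<notin> P}" "y \<in> {Fract a b | a b. b \<notin> P}"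
    then obtain a b c d where *: "x = Fract a b" "b \<notin> P" "y = Fract c d" "d \<notin> P" by auto
    then have "b \<noteq> 0" "d \<noteq> 0" "b * d \<notin> P" using D by auto
    then show "x \<otimes>\<^bsub>ring_of TYPE('a fract)\<^esub> y \<in> {Fract a b | a b. b \<notin> P}"
      and "x \<oplus>\<^bsub>ring_of TYPE('a fract)\<^esub> y \<in> {Fract a b | a b. b \<notin> P}"
      using * by auto
  next
    fix x :: "'a fract"
    assume "x \<in> {Fract a b | a b. b \<notin> P}"
    then obtain a b where "x = Fract a b" "b \<notin> P" by auto
    then have "- x = Fract (- a) b" "b \<notin> P" by auto
    then show "\<ominus>\<^bsub>ring_of TYPE('a fract)\<^esub> x \<in> {Fract a b | a b. b \<notin> P}"
      unfolding neg by blast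
  qed simp
  then show ?thesis unfolding local_ring_def by (rule subring_is_ring)
qed

text \<open>Clearing denominators replaces the fraction field by a multiplier \<open>b\<close>
  outside \<open>P\<close>; all later arguments stay in the polynomial ring.\<close>

lemma Fract_mem_extend_local_iff:
  fixes P :: "'a::idom set"
  assumes P: "is_prime_ideal P" and J: "ideal J (ring_of TYPE('a))"
  shows "Fract f 1 \<in> extend_local P J \<longleftrightarrow> (\<exists>b. b \<notin> P \<and> b * f \<in> J)"
proof -
  note D = is_prime_idealD[OF P]
  interpret ring "local_ring P" by (rule local_ring_ring[OF P])
  have ops: "carrier (local_ring P) = {Fract a b | a b. b \<notin> P}"
    "x \<otimes>\<^bsub>local_ring P\<^esub> y = x * y" "x \<oplus>\<^bsub>local_ring P\<^esub> y = x + y" "\<zero>\<^bsub>local_ring P\<^esub> = 0" for x y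
    by (simp_all add: local_ring_def)
  have J0: "0 \<in> J" and Jadd: "\<And>a b. a \<in> J \<Longrightarrow> b \<in> J \<Longrightarrow> a + b \<in> J"
    and Jmul': "\<And>a r. a \<in> J \<Longrightarrow> a * r \<in> J"
    using J by (auto simp: ideal_ring_of_iff mult.commute)
  \<comment> \<open>These fractions form an ideal containing the image of \<open>J\<close>, so the
    generated ideal lies in \<open>S\<close> and its elements have numerator in
    \<open>J\<close>.\<close>
  define S where "S = {Fract a b | a b. a \<in> J \<and> b \<notin> P}"
  have mult_S: "x * y \<in> S" if x: "x \<in> S" and y: "y \<in> carrier (local_ring P)" for x y
  proof -
    from x y obtain a b c d where *: "x = Fract a b" "a \<in> J" "b \<notin> P" "y = Fract c d" "d \<notin> P"
      by (auto simp: S_def ops)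
    then have "x * y = Fract (a * c) (b * d)" "a * c \<in> J" "b * d \<notin> P" using D Jmul' by auto
    then show ?thesis by (auto simp: S_def)
  qed
  have "ideal S (local_ring P)"
  proof (rule idealI_closed)
    show "S \<subseteq> carrier (local_ring P)" by (auto simp: S_def ops)
    show "\<zero>\<^bsub>local_ring P\<^esub> \<in> S" using J0 D(2) by (auto simp: S_def ops Zero_fract_def)
    fix x y assume "x \<in> S" "y \<in> S"
    then obtain a b c d where *: "x = Fract a b" "a \<in> J" "b \<notin> P" "y = Fract c d" "c \<in> J" "d \<notin> P"
      by (auto simp: S_def)
    then have "b \<noteq> 0" "d \<noteq> 0" and bd: "b * d \<notin> P" using D by auto
    then have "x + y = Fract (a * d + c * b) (b * d)" using * by simp
    moreover have "a * d + c * b \<in> J" using * by (intro Jadd Jmul')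
    ultimately show "x \<oplus>\<^bsub>local_ring P\<^esub> y \<in> S"
      using bd unfolding S_def ops by blast
  next
    fix x y assume "x \<in> S" "y \<in> carrier (local_ring P)"
    then show "y \<otimes>\<^bsub>local_ring P\<^esub> x \<in> S" "x \<otimes>\<^bsub>local_ring P\<^esub> y \<in> S"
      using mult_S[of x y] by (auto simp: ops mult.commute)
  qed
  moreover have "(\<lambda>f. Fract f 1) ` J \<subseteq> S" using D(2) by (auto simp: S_def)
  ultimately have sub: "extend_local P J \<subseteq> S" by (auto simp: extend_local_def genideal_def)
  show ?thesis
  proof
    assume "Fract f 1 \<in> extend_local P J"
    then have "Fract f 1 \<in> S" using sub by auto
    then obtain a b where ab: "Fract f 1 = Fract a b" "a \<in> J" "b \<notin> P" by (auto simp: S_def)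
    then have "b \<noteq> 0" using D by auto
    then have "b * f = a" using ab(1) by (simp add: eq_fract mult.commute)
    then show "\<exists>b. b \<notin> P \<and> b * f \<in> J" using ab by auto
  next
    assume "\<exists>b. b \<notin> P \<and> b * f \<in> J"
    then obtain b where b: "b \<notin> P" "b * f \<in> J" by auto
    then have "b \<noteq> 0" using D by auto
    then have eq: "Fract f 1 = Fract 1 b \<otimes>\<^bsub>local_ring P\<^esub> Fract (b * f) 1"
      by (simp add: ops eq_fract)
    have sub: "(\<lambda>f. Fract f 1) ` J \<subseteq> carrier (local_ring P)" using D(2) by (auto simp: ops)
    interpret E: ideal "extend_local P J" "local_ring P"
      unfolding extend_local_def by (rule genideal_ideal[OF sub])
    have "Fract (b * f) 1 \<in> extend_local P J"
      using genideal_self[OF sub] b by (auto simp: extend_local_def)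
    then show "Fract f 1 \<in> extend_local P J"
      unfolding eq by (rule E.I_l_closed) (use b in \<open>auto simp: ops\<close>)
  qed
qed

lemma symbolic_power_iff:
  fixes I :: "'a::idom set"
  assumes "ideal I (ring_of TYPE('a))"
  shows "f \<in> symbolic_power I s \<longleftrightarrow> (\<forall>P\<in>Ass I. \<exists>b. b \<notin> P \<and> b * f \<in> ideal_power I s)"
  using Fract_mem_extend_local_iff[OF _ ideal_power_ideal[OF assms], of _ f s]
  by (auto simp: symbolic_power_def Ass_def)

lemma ideal_power_subset_symbolic_power:
  fixes I :: "'a::idom set"
  assumes "ideal I (ring_of TYPE('a))"
  shows "ideal_power I s \<subseteq> symbolic_power I s"
proof
  fix f assume f: "f \<in> ideal_power I s"
  show "f \<in> symbolic_power I s"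
    unfolding symbolic_power_iff[OF assms]
  proof
    fix P assume "P \<in> Ass I"
    then have "1 \<notin> P" by (intro is_prime_idealD) (auto simp: Ass_def)
    then show "\<exists>b. b \<notin> P \<and> b * f \<in> ideal_power I s" using f by (intro exI[of _ 1]) auto
  qed
qed

text \<open>The multipliers of the two factors multiply to one that is again outside the prime
  \<open>P\<close>. This is the source of subadditivity.\<close>

lemma symbolic_power_mult:
  fixes I :: "'a::idom set"
  assumes I: "ideal I (ring_of TYPE('a))"
    and f: "f \<in> symbolic_power I s" and g: "g \<in> symbolic_power I u"
  shows "f * g \<in> symbolic_power I (s + u)"
  unfolding symbolic_power_iff[OF I]
proof
  fix P assume P: "P \<in> Ass I"
  then have pr: "is_prime_ideal P" by (auto simp: Ass_def)
  obtain b c where b: "b \<notin> P" "b * f \<in> ideal_power I s" and c: "c \<notin> P" "c * g \<in> ideal_power I u"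
    using f g P unfolding symbolic_power_iff[OF I] by blast
  have "b * c \<notin> P" using is_prime_idealD(3)[OF pr] b c by blast
  moreover have "(b * c) * (f * g) \<in> ideal_power I (s + u)"
    using ideal_power_mult[OF I b(2) c(2)] by (simp add: ac_simps)
  ultimately show "\<exists>d. d \<notin> P \<and> d * (f * g) \<in> ideal_power I (s + u)" by blast
qed

subsection \<open>Fekete's lemma\<close>

lemma subadditive_le_mult:
  fixes a :: "nat \<Rightarrow> real"
  assumes sub: "\<And>m n. a (m + n) \<le> a m + a n"
  shows "a (q * m + r) \<le> real q * a m + a r"
proof (induction q)
  case (Suc q)
  have "a (Suc q * m + r) = a (m + (q * m + r))" by (simp add: ac_simps)
  also have "\<dots> \<le> a m + a (q * m + r)" by (rule sub)
  finally show ?case using Suc by (simp add: algebra_simps)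
qed simp

text \<open>The limit is the infimum over positive indices, which exists because the sequence is
  nonnegative.\<close>

lemma fekete_convergent:
  fixes a :: "nat \<Rightarrow> real"
  assumes nonneg: "\<And>n. 0 \<le> a n" and sub: "\<And>m n. a (m + n) \<le> a m + a n"
  shows "convergent (\<lambda>n. a n / real n)"
proof -
  define L where "L = (INF n\<in>{1..}. a n / real n)"
  have bdd: "bdd_below ((\<lambda>n. a n / real n) ` {1..})"
    by (rule bdd_belowI2[of _ 0]) (simp add: nonneg)
  have "(\<lambda>n. a n / real n) \<longlonglongrightarrow> L"
  proof (rule LIMSEQ_I)
    fix e :: real assume e: "0 < e"
    have "\<exists>m\<in>{1..}. a m / real m < L + e / 2"
      using cINF_less_iff[OF _ bdd, of "L + e / 2"] e by (auto simp: L_def)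
    then obtain m where m: "m \<ge> 1" "a m / real m < L + e / 2" by auto
    \<comment> \<open>Division of \<open>n\<close> by the fixed good index \<open>m\<close> leaves a
      remainder below \<open>m\<close>; \<open>B\<close> bounds all these remainder terms at once,
      and its share vanishes after division by \<open>n\<close>.\<close>
    define B where "B = (\<Sum>r<m. a r)"
    have aB: "a r \<le> B" if "r < m" for r
      unfolding B_def using that nonneg by (intro member_le_sum) auto
    obtain N :: nat where N: "real N > 2 * B / e" using reals_Archimedean2 by blast
    show "\<exists>no. \<forall>n\<ge>no. norm (a n / real n - L) < e"
    proof (intro exI allI impI)
      fix n assume n: "max 1 N \<le> n"
      then have n0: "real n > 0" by auto
      have ge: "L \<le> a n / real n" unfolding L_def using n by (intro cINF_lower[OF bdd]) auto
      have "a n = a (n div m * m + n mod m)" by simp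
      also have "\<dots> \<le> real (n div m) * a m + a (n mod m)" by (rule subadditive_le_mult[OF sub])
      also have "\<dots> \<le> real (n div m) * a m + B" using aB[of "n mod m"] m by simp
      also have "real (n div m) * a m = real (n div m * m) * (a m / real m)" using m by simp
      also have "\<dots> \<le> real n * (a m / real m)"
        using nonneg by (intro mult_right_mono) (auto simp del: of_nat_mult)
      finally have "a n / real n \<le> a m / real m + B / real n"
        using n0 by (simp add: field_simps)
      moreover have "B / real n < e / 2"
      proof -
        have "2 * B / e < real n" using N n by linarith
        then show ?thesis using e n0 by (simp add: field_simps)
      qed
      ultimately have "a n / real n < L + e" using m by linarith
      then show "norm (a n / real n - L) < e" using ge by simp
    qed
  qed
  then show ?thesis by (rule convergentI)
qed


subsection \<open>Monomial valuations and monomial ideals\<close>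

text \<open>Initial forms multiply: the product of the parts of lowest weight is nonzero because the
  monoid algebra is a domain, and nothing else can cancel it. Hence the minimal weight is a
  valuation.\<close>

lemma exists_key_of_min_weight:
  fixes \<phi> :: "'m::{ordered_cancel_comm_monoid_add,linorder} \<Rightarrow> real"
    and f g :: "'m \<Rightarrow>\<^sub>0 'k::field"
  assumes hom: "\<And>a b. \<phi> (a + b) = \<phi> a + \<phi> b"
    and a: "a \<in> Poly_Mapping.keys f" "\<And>u. u \<in> Poly_Mapping.keys f \<Longrightarrow> \<phi> a \<le> \<phi> u"
    and b: "b \<in> Poly_Mapping.keys g" "\<And>u. u \<in> Poly_Mapping.keys g \<Longrightarrow> \<phi> b \<le> \<phi> u"
  shows "\<exists>c\<in>Poly_Mapping.keys (f * g). \<phi> c = \<phi> a + \<phi> b"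
proof -
  \<comment> \<open>\<open>pick Q p\<close> keeps the terms of \<open>p\<close> whose exponent
    satisfies \<open>Q\<close>; below, \<open>f0\<close> and \<open>g0\<close> are the initial
    forms.\<close>
  define pick :: "('m \<Rightarrow> bool) \<Rightarrow> ('m \<Rightarrow>\<^sub>0 'k) \<Rightarrow> 'm \<Rightarrow>\<^sub>0 'k"
    where "pick Q p = Poly_Mapping.mapp (\<lambda>u c. c when Q u) p" for Q p
  have lookup_pick: "Poly_Mapping.lookup (pick Q p) u = (Poly_Mapping.lookup p u when Q u)" for Q p u
    by (auto simp: pick_def lookup_mapp when_def in_keys_iff)
  have keys_pick: "Poly_Mapping.keys (pick Q p) = {u \<in> Poly_Mapping.keys p. Q u}" for Q p
    by (auto simp: in_keys_iff lookup_pick when_def split: if_splits)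
  have split: "p = pick Q p + pick (\<lambda>u. \<not> Q u) p" for Q p
    by (rule poly_mapping_eqI) (auto simp: lookup_add lookup_pick when_def)
  define f0 f1 g0 g1 where "f0 = pick (\<lambda>u. \<phi> u = \<phi> a) f" and "f1 = pick (\<lambda>u. \<phi> u \<noteq> \<phi> a) f"
    and "g0 = pick (\<lambda>u. \<phi> u = \<phi> b) g" and "g1 = pick (\<lambda>u. \<phi> u \<noteq> \<phi> b) g"
  have f: "f = f0 + f1" and g: "g = g0 + g1" unfolding f0_def f1_def g0_def g1_def by (rule split)+
  have k0: "\<phi> u = \<phi> a" if "u \<in> Poly_Mapping.keys f0" for u using that by (auto simp: f0_def keys_pick)
  have k0': "\<phi> u = \<phi> b" if "u \<in> Poly_Mapping.keys g0" for u using that by (auto simp: g0_def keys_pick)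
  have k1: "\<phi> u > \<phi> a" if "u \<in> Poly_Mapping.keys f1" for u
    using that a(2)[of u] by (auto simp: f1_def keys_pick)
  have k1': "\<phi> u > \<phi> b" if "u \<in> Poly_Mapping.keys g1" for u
    using that b(2)[of u] by (auto simp: g1_def keys_pick)
  have "a \<in> Poly_Mapping.keys f0" "b \<in> Poly_Mapping.keys g0"
    using a(1) b(1) by (auto simp: f0_def g0_def keys_pick)
  then have "f0 * g0 \<noteq> 0" by auto
  then obtain c where c: "c \<in> Poly_Mapping.keys (f0 * g0)"
    by (metis all_not_in_conv keys_eq_empty)
  then have \<phi>c: "\<phi> c = \<phi> a + \<phi> b"
    using keys_mult[of f0 g0] k0 k0' by (fastforce simp: hom)
  \<comment> \<open>The remaining products only have exponents of weight strictly above
    \<open>\<phi> a + \<phi> b\<close>.\<close>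
  have "c \<notin> Poly_Mapping.keys (f1 * g)"
  proof
    assume "c \<in> Poly_Mapping.keys (f1 * g)"
    then obtain u v where "c = u + v" "u \<in> Poly_Mapping.keys f1" "v \<in> Poly_Mapping.keys g"
      using keys_mult[of f1 g] by blast
    then show False using k1[of u] b(2)[of v] \<phi>c by (simp add: hom)
  qed
  moreover have "c \<notin> Poly_Mapping.keys (f0 * g1)"
  proof
    assume "c \<in> Poly_Mapping.keys (f0 * g1)"
    then obtain u v where "c = u + v" "u \<in> Poly_Mapping.keys f0" "v \<in> Poly_Mapping.keys g1"
      using keys_mult[of f0 g1] by blast
    then show False using k0[of u] k1'[of v] \<phi>c by (simp add: hom)
  qed
  moreover have "f * g = f0 * g0 + f0 * g1 + f1 * g" unfolding f g by (simp only: distrib_left distrib_right ac_simps)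
  ultimately have "c \<in> Poly_Mapping.keys (f * g)"
    using c by (simp add: in_keys_iff lookup_add)
  then show ?thesis using \<phi>c by blast
qed

text \<open>A factor with a term of weight 0 has valuation 0, so multiplying by it does not change
  the minimal weight of \<open>f\<close>. This removes the multipliers that come from
  localization.\<close>

lemma weight_cancel_left:
  fixes \<phi> :: "'m::{ordered_cancel_comm_monoid_add,linorder} \<Rightarrow> real"
    and f b :: "'m \<Rightarrow>\<^sub>0 'k::field"
  assumes hom: "\<And>a b. \<phi> (a + b) = \<phi> a + \<phi> b" and nonneg: "\<And>u. 0 \<le> \<phi> u"
    and v: "v \<in> Poly_Mapping.keys b" "\<phi> v = 0"
    and bf: "\<And>u. u \<in> Poly_Mapping.keys (b * f) \<Longrightarrow> s \<le> \<phi> u"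
    and u: "u \<in> Poly_Mapping.keys f"
  shows "s \<le> \<phi> u"
proof -
  define x where "x = arg_min_on \<phi> (Poly_Mapping.keys f)"
  have x: "x \<in> Poly_Mapping.keys f" "\<And>y. y \<in> Poly_Mapping.keys f \<Longrightarrow> \<phi> x \<le> \<phi> y"
    unfolding x_def using u by (auto intro!: arg_min_if_finite(1) arg_min_least)
  then obtain c where "c \<in> Poly_Mapping.keys (b * f)" "\<phi> c = \<phi> v + \<phi> x"
    using exists_key_of_min_weight[where \<phi> = \<phi>, OF hom v(1) _ x] v(2) nonneg by auto
  then show ?thesis using bf[of c] x(2)[OF u] v(2) by simp
qed

text \<open>For positive \<open>w\<close>, the weight is normalized so that each generator
  \<open>Var i ^ w i\<close> of \<open>irred_ideal A w\<close> has weight exactly 1.\<close>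

definition wdeg :: "'n::finite set \<Rightarrow> ('n \<Rightarrow> nat) \<Rightarrow> ('n \<Rightarrow>\<^sub>0 nat) \<Rightarrow> real" where
  "wdeg A w u = (\<Sum>i\<in>A. real (Poly_Mapping.lookup u i) / real (w i))"

lemma wdeg_add: "wdeg A w (u + v) = wdeg A w u + wdeg A w v"
  by (simp add: wdeg_def lookup_add add_divide_distrib sum.distrib)

lemma wdeg_nonneg: "0 \<le> wdeg A w u"
  by (auto simp: wdeg_def intro!: sum_nonneg)

lemma wdeg_eq_0_iff:
  fixes A :: "'n::finite set"
  assumes "\<forall>i\<in>A. 1 \<le> w i"
  shows "wdeg A w u = 0 \<longleftrightarrow> (\<forall>i\<in>A. Poly_Mapping.lookup u i = 0)"
  unfolding wdeg_def by (subst sum_nonneg_eq_0_iff) (use assms in force)+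

lemma one_le_wdeg:
  fixes A :: "'n::finite set"
  assumes "i \<in> A" "1 \<le> w i" "w i \<le> Poly_Mapping.lookup u i"
  shows "1 \<le> wdeg A w u"
proof -
  have "1 \<le> real (Poly_Mapping.lookup u i) / real (w i)" using assms by (simp add: field_simps)
  also have "\<dots> \<le> wdeg A w u" unfolding wdeg_def by (rule member_le_sum) (use assms in auto)
  finally show ?thesis .
qed

text \<open>This is the prime generated by the variables in \<open>A\<close>, described by exponents
  so that membership can be read off the terms.\<close>

definition var_ideal :: "'n set \<Rightarrow> ('n, 'k::field) mpoly set" where
  "var_ideal A = {f. \<forall>u\<in>Poly_Mapping.keys f. \<exists>i\<in>A. Poly_Mapping.lookup u i \<noteq> 0}"

lemma ideal_of_keys:
  fixes Q :: "('n \<Rightarrow>\<^sub>0 nat) \<Rightarrow> bool"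
  assumes "\<And>u v. Q u \<Longrightarrow> Q (v + u)"
  shows "ideal {f :: ('n, 'k::field) mpoly. \<forall>u\<in>Poly_Mapping.keys f. Q u} (ring_of TYPE(('n, 'k) mpoly))"
  unfolding ideal_ring_of_iff
proof (intro conjI ballI allI)
  fix f g :: "('n, 'k) mpoly"
  assume "f \<in> {f. \<forall>u\<in>Poly_Mapping.keys f. Q u}" "g \<in> {f. \<forall>u\<in>Poly_Mapping.keys f. Q u}"
  then show "f + g \<in> {f. \<forall>u\<in>Poly_Mapping.keys f. Q u}"
    using Poly_Mapping.keys_add[of f g] by blast
next
  fix f r :: "('n, 'k) mpoly"
  assume "f \<in> {f. \<forall>u\<in>Poly_Mapping.keys f. Q u}"
  then show "r * f \<in> {f. \<forall>u\<in>Poly_Mapping.keys f. Q u}"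
    using keys_mult[of r f] assms by blast
qed simp

text \<open>With all \<open>w i\<close> equal to 1, the weight is the degree in the variables of
  \<open>A\<close>, and a polynomial lies outside the ideal iff it has a term of weight 0. By the
  valuation property, a product of two such polynomials has one too.\<close>

lemma var_ideal_prime:
  fixes A :: "'n::{finite,linorder} set"
  shows "is_prime_ideal (var_ideal A :: ('n, 'k::field) mpoly set)"
proof (rule is_prime_idealI)
  show "ideal (var_ideal A :: ('n, 'k) mpoly set) (ring_of TYPE(('n, 'k) mpoly))"
    unfolding var_ideal_def by (rule ideal_of_keys) (auto simp: lookup_add)
  have "(1 :: ('n, 'k) mpoly) \<notin> var_ideal A" by (auto simp: var_ideal_def)
  then show "(var_ideal A :: ('n, 'k) mpoly set) \<noteq> UNIV" by blast
  fix f g :: "('n, 'k) mpoly"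
  assume fg: "f * g \<in> var_ideal A"
  show "f \<in> var_ideal A \<or> g \<in> var_ideal A"
  proof (rule ccontr)
    assume "\<not> ?thesis"
    then obtain u v where u: "u \<in> Poly_Mapping.keys f" "\<forall>i\<in>A. Poly_Mapping.lookup u i = 0"
      and v: "v \<in> Poly_Mapping.keys g" "\<forall>i\<in>A. Poly_Mapping.lookup v i = 0"
      by (auto simp: var_ideal_def)
    then have 0: "wdeg A (\<lambda>_. 1) u = 0" "wdeg A (\<lambda>_. 1) v = 0"
      by (simp_all add: wdeg_def)
    obtain c where "c \<in> Poly_Mapping.keys (f * g)" "wdeg A (\<lambda>_. 1) c = 0"
      using exists_key_of_min_weight[where \<phi> = "wdeg A (\<lambda>_. 1)", OF wdeg_add u(1) _ v(1)] 0 wdeg_nonneg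
      by auto
    then show False using fg by (auto simp: var_ideal_def wdeg_eq_0_iff)
  qed
qed

section \<open>Monomial membership in irreducible ideals and their intersections\<close>

lemma Var_power: "(Var i ^ n :: ('n, 'k::field) mpoly) = Poly_Mapping.single (Poly_Mapping.single i n) 1"
  by (induction n) (simp_all add: Var_def mult_single flip: single_add)

lemma update_eq_add_single:
  assumes "a \<notin> Poly_Mapping.keys f"
  shows "Poly_Mapping.update a b f = f + Poly_Mapping.single a b"
  using assms by (intro poly_mapping_eqI) (auto simp: lookup_update lookup_add lookup_single in_keys_iff)

lemma mem_ideal_of_monomials:
  fixes J :: "('n, 'k::field) mpoly set"
  assumes "\<And>u. u \<in> Poly_Mapping.keys f \<Longrightarrow> Poly_Mapping.single u 1 \<in> J"
    and J: "ideal J (ring_of TYPE(('n, 'k) mpoly))"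
  shows "f \<in> J"
  using assms(1)
proof (induction f rule: update_induct)
  case const
  then show ?case using J by (simp add: ideal_ring_of_iff)
next
  case (update f a b)
  have "Poly_Mapping.single 0 b * Poly_Mapping.single a 1 \<in> J"
    using J update by (auto simp: ideal_ring_of_iff keys_update)
  moreover have "f \<in> J" using update by (auto simp: keys_update)
  ultimately show ?case
    using J update(1) by (simp add: update_eq_add_single mult_single ideal_ring_of_iff)
qed

text \<open>Membership in a monomial ideal is decided term by term, and a monomial belongs iff a
  generator divides it.\<close>

lemma irred_ideal_eq:
  fixes A :: "'n set"
  shows "(irred_ideal A w :: ('n, 'k::field) mpoly set) =
    {f. \<forall>u\<in>Poly_Mapping.keys f. \<exists>i\<in>A. w i \<le> Poly_Mapping.lookup u i}"
    (is "?J = ?K")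
proof (rule antisym)
  have "\<exists>i\<in>A. w i \<le> Poly_Mapping.lookup (v + u) i"
    if "\<exists>i\<in>A. w i \<le> Poly_Mapping.lookup u i" for u v :: "'n \<Rightarrow>\<^sub>0 nat"
  proof -
    from that obtain i where "i \<in> A" "w i \<le> Poly_Mapping.lookup u i" by blast
    then show ?thesis by (intro bexI[of _ i]) (simp_all add: lookup_add)
  qed
  then have "ideal ?K (ring_of TYPE(('n, 'k) mpoly))" by (rule ideal_of_keys)
  moreover have "Var i ^ w i \<in> ?K" if "i \<in> A" for i
    by (simp add: Var_power) (rule bexI[of _ i], simp_all add: that)
  then have "(\<lambda>i. Var i ^ w i) ` A \<subseteq> ?K" by (rule image_subsetI)
  ultimately show "?J \<subseteq> ?K" unfolding irred_ideal_def by (rule ideal_gen_minimal)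
next
  have J: "ideal ?J (ring_of TYPE(('n, 'k) mpoly))"
    unfolding irred_ideal_def by (rule ideal_gen_ideal)
  show "?K \<subseteq> ?J"
  proof (rule subsetI)
    fix f assume f: "f \<in> ?K"
    show "f \<in> ?J"
    proof (rule mem_ideal_of_monomials[OF _ J])
      fix u assume "u \<in> Poly_Mapping.keys f"
      then obtain i where i: "i \<in> A" "w i \<le> Poly_Mapping.lookup u i" using f by blast
      have "Var i ^ w i \<in> ?J"
        unfolding irred_ideal_def using i(1) by (intro subsetD[OF ideal_gen_self] imageI)
      \<comment> \<open>The cofactor of the generator; the truncated subtraction is exact since
        \<open>w i\<close> is at most the exponent of \<open>u\<close> at \<open>i\<close>.\<close>
      then have "Poly_Mapping.single (u - Poly_Mapping.single i (w i)) 1 * Var i ^ w i \<in> ?J"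
        using J unfolding ideal_ring_of_iff by blast
      moreover have "u - Poly_Mapping.single i (w i) + Poly_Mapping.single i (w i) = u"
        using i(2) by (intro poly_mapping_eqI) (auto simp: lookup_add lookup_minus lookup_single when_def)
      ultimately show "Poly_Mapping.single u 1 \<in> ?J"
        by (simp add: Var_power mult_single)
    qed
  qed
qed

lemma lookup_mult_single:
  fixes g :: "('n, 'k::field) mpoly"
  shows "Poly_Mapping.lookup (g * Poly_Mapping.single m 1) (u + m) = Poly_Mapping.lookup g u"
proof (induction g rule: update_induct)
  case (update f a b)
  then show ?case
    by (simp add: update_eq_add_single distrib_right lookup_add mult_single lookup_single)
qed simp

lemma keys_mult_single:
  fixes g :: "('n, 'k::field) mpoly"
  shows "Poly_Mapping.keys (g * Poly_Mapping.single m 1) = (\<lambda>u. u + m) ` Poly_Mapping.keys g"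
  using keys_mult[of g "Poly_Mapping.single m 1"]
  by (auto simp: in_keys_iff lookup_mult_single)

lemma min_irred_decomp_eq:
  fixes I :: "('n, 'k::field) mpoly set"
  assumes "min_irred_decomp I r A w"
  shows "I = {f. \<forall>u\<in>Poly_Mapping.keys f. \<forall>j\<in>{1..r}. \<exists>i\<in>A j. w j i \<le> Poly_Mapping.lookup u i}"
  using assms by (auto simp: min_irred_decomp_def irred_ideal_eq)

lemma min_irred_decomp_ideal:
  fixes I :: "('n, 'k::field) mpoly set"
  assumes "min_irred_decomp I r A w"
  shows "ideal I (ring_of TYPE(('n, 'k) mpoly))"
  unfolding min_irred_decomp_eq[OF assms]
proof (rule ideal_of_keys, rule ballI)
  fix u v :: "'n \<Rightarrow>\<^sub>0 nat" and j
  assume "\<forall>j\<in>{1..r}. \<exists>i\<in>A j. w j i \<le> Poly_Mapping.lookup u i" and "j \<in> {1..r}"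
  then obtain i where "i \<in> A j" "w j i \<le> Poly_Mapping.lookup u i" by blast
  then show "\<exists>i\<in>A j. w j i \<le> Poly_Mapping.lookup (v + u) i"
    by (intro bexI[of _ i]) (simp_all add: lookup_add)
qed

text \<open>Each radical is realized as a colon ideal of \<open>I\<close> by a monomial, which
  irredundancy supplies.\<close>

lemma var_ideal_in_Ass:
  fixes I :: "('n::{finite,linorder}, 'k::field) mpoly set"
  assumes dec: "min_irred_decomp I r A w" and j: "j \<in> {1..r}"
  shows "var_ideal (A j) \<in> Ass I"
proof -
  define Q where "Q k u \<longleftrightarrow> (\<exists>i\<in>A k. w k i \<le> Poly_Mapping.lookup u i)" for k and u :: "'n \<Rightarrow>\<^sub>0 nat"
  have w: "\<And>i. i \<in> A j \<Longrightarrow> 1 \<le> w j i" using dec j by (auto simp: min_irred_decomp_def)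
  have I: "I = {f. \<forall>u\<in>Poly_Mapping.keys f. \<forall>k\<in>{1..r}. Q k u}"
    unfolding Q_def by (rule min_irred_decomp_eq[OF dec])
  have "\<forall>j\<in>{1..r}. I \<noteq> (\<Inter>k\<in>{1..r} - {j}. irred_ideal (A k) (w k))"
    using dec unfolding min_irred_decomp_def by (elim conjE)
  then have "I \<noteq> (\<Inter>k\<in>{1..r} - {j}. irred_ideal (A k) (w k))" using j by (rule bspec)
  moreover have "I \<subseteq> (\<Inter>k\<in>{1..r} - {j}. irred_ideal (A k) (w k))"
    unfolding I irred_ideal_eq Q_def by blast
  \<comment> \<open>By irredundancy some \<open>f\<close> lies in all other components but not in
    \<open>I\<close>; a term of \<open>f\<close> that violates the description of \<open>I\<close>
    can only violate the \<open>j\<close>-th condition.\<close>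
  ultimately obtain f where f: "f \<in> (\<Inter>k\<in>{1..r} - {j}. irred_ideal (A k) (w k))" "f \<notin> I" by blast
  then obtain m where m: "m \<in> Poly_Mapping.keys f" and "\<not> (\<forall>k\<in>{1..r}. Q k m)"
    unfolding I by blast
  moreover have Qm: "Q k m" if "k \<in> {1..r} - {j}" for k
    using f(1) that m unfolding irred_ideal_eq Q_def by blast
  ultimately have "\<not> Q j m" by blast
  \<comment> \<open>Raising the exponents of \<open>m\<close> on \<open>A j\<close> to the largest values that keep it outside \<open>q\<^sub>j\<close>
    makes \<open>(I : x\<^sup>m)\<close> equal to the radical of \<open>q\<^sub>j\<close>.\<close>
  define m' where "m' = Abs_poly_mapping (\<lambda>i. if i \<in> A j then w j i - 1 else Poly_Mapping.lookup m i)"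
  have m': "Poly_Mapping.lookup m' i = (if i \<in> A j then w j i - 1 else Poly_Mapping.lookup m i)" for i
    unfolding m'_def by (subst lookup_Abs_poly_mapping) auto
  have le: "Poly_Mapping.lookup m i \<le> Poly_Mapping.lookup m' i" for i
    using \<open>\<not> Q j m\<close> by (force simp: Q_def m')
  have 1: "Q k (u + m')" if k: "k \<in> {1..r} - {j}" for k u
  proof -
    obtain i where "i \<in> A k" "w k i \<le> Poly_Mapping.lookup m i"
      using Qm[OF k] unfolding Q_def by blast
    then show ?thesis
      using le[of i] unfolding Q_def by (intro bexI[of _ i]) (simp_all add: lookup_add)
  qed
  \<comment> \<open>On \<open>A j\<close> the exponents of \<open>m'\<close> are exactly one below
    the thresholds, which are positive, so any variable of \<open>A j\<close> in \<open>u\<close>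
    reaches one.\<close>
  have 2: "Q j (u + m') \<longleftrightarrow> (\<exists>i\<in>A j. Poly_Mapping.lookup u i \<noteq> 0)" for u
    unfolding Q_def
  proof (rule bex_cong[OF refl])
    fix i assume "i \<in> A j"
    then show "w j i \<le> Poly_Mapping.lookup (u + m') i \<longleftrightarrow> Poly_Mapping.lookup u i \<noteq> 0"
      using w[of i] by (auto simp: lookup_add m')
  qed
  have 3: "(\<forall>k\<in>{1..r}. Q k (u + m')) \<longleftrightarrow> (\<exists>i\<in>A j. Poly_Mapping.lookup u i \<noteq> 0)" for u
    using 1 2 j by blast
  have "g * Poly_Mapping.single m' 1 \<in> I \<longleftrightarrow> g \<in> var_ideal (A j)" for g
  proof -
    have "g * Poly_Mapping.single m' 1 \<in> I \<longleftrightarrow>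
        (\<forall>u\<in>(\<lambda>u. u + m') ` Poly_Mapping.keys g. \<forall>k\<in>{1..r}. Q k u)"
      unfolding I mem_Collect_eq by (subst keys_mult_single) (rule refl)
    then show ?thesis unfolding var_ideal_def mem_Collect_eq ball_simps 3 .
  qed
  then have "var_ideal (A j) = {g. g * Poly_Mapping.single m' 1 \<in> I}" by auto
  then show ?thesis unfolding Ass_def using var_ideal_prime[of "A j"] by blast
qed

subsection \<open>Initial degrees\<close>

lemma mdeg_add: "mdeg (u + v) = mdeg u + mdeg v"
  by (simp add: mdeg_def lookup_add sum.distrib)

lemma alpha_le:
  assumes "f \<in> L" "f \<noteq> 0" "\<And>u. u \<in> Poly_Mapping.keys f \<Longrightarrow> mdeg u = d"
  shows "alpha L \<le> d"
  unfolding alpha_def by (rule Least_le) (use assms in \<open>auto simp: homog_part_def\<close>)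

lemma alpha_attained:
  assumes "0 \<in> L" "f \<in> L" "f \<noteq> 0" "\<And>u. u \<in> Poly_Mapping.keys f \<Longrightarrow> mdeg u = d"
  obtains g where "g \<in> L" "g \<noteq> 0" "\<And>u. u \<in> Poly_Mapping.keys g \<Longrightarrow> mdeg u = alpha L"
proof -
  have "homog_part L d \<noteq> {0}" using assms by (auto simp: homog_part_def)
  then have "homog_part L (alpha L) \<noteq> {0}" unfolding alpha_def by (rule LeastI)
  \<comment> \<open>An empty part would also differ from \<open>{0}\<close>; knowing that it
    contains 0 turns the inequality into a nonzero element.\<close>
  moreover have "0 \<in> homog_part L (alpha L)" using assms(1) by (simp add: homog_part_def)
  ultimately have "\<exists>g\<in>homog_part L (alpha L). g \<noteq> 0" by blast
  then show ?thesis using that by (auto simp: homog_part_def)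
qed

text \<open>The \<open>s\<close>-th power of a monomial of \<open>I\<close> is a nonzero homogeneous
  element, so the least degree is taken over a nonempty set.\<close>

lemma alpha_symbolic_power_attained:
  fixes I :: "('n::{finite,linorder}, 'k::field) mpoly set"
  assumes I: "ideal I (ring_of TYPE(('n, 'k) mpoly))" and m: "Poly_Mapping.single m 1 \<in> I"
  obtains g where "g \<in> symbolic_power I s" "g \<noteq> 0"
    "\<And>u. u \<in> Poly_Mapping.keys g \<Longrightarrow> mdeg u = alpha (symbolic_power I s)"
proof -
  note sub = ideal_power_subset_symbolic_power[OF I, of s]
  let ?f = "Poly_Mapping.single m 1 :: ('n, 'k) mpoly"
  show ?thesis
  proof (rule alpha_attained[of "symbolic_power I s" "?f ^ s" "s * mdeg m"])
    show "0 \<in> symbolic_power I s"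
      using sub ideal_power_ideal[OF I, of s] by (auto simp: ideal_ring_of_iff)
    show "?f ^ s \<in> symbolic_power I s" using sub power_in_ideal_power[OF I m] by auto
    have "?f \<noteq> 0" by (simp flip: keys_eq_empty)
    then show "?f ^ s \<noteq> 0" by simp
    show "mdeg u = s * mdeg m" if "u \<in> Poly_Mapping.keys (?f ^ s)" for u
      using that
    proof (induction s arbitrary: u)
      case (Suc s)
      then obtain v where "v \<in> Poly_Mapping.keys (?f ^ s)" "u = m + v"
        using keys_mult[of ?f "?f ^ s"] by auto
      then show ?case using Suc by (simp add: mdeg_add)
    qed (simp add: mdeg_def)
  qed (use that in blast)
qed

lemma alpha_symbolic_power_add_le:
  fixes I :: "('n::{finite,linorder}, 'k::field) mpoly set"
  assumes I: "ideal I (ring_of TYPE(('n, 'k) mpoly))" and m: "Poly_Mapping.single m 1 \<in> I"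
  shows "alpha (symbolic_power I (s + u)) \<le> alpha (symbolic_power I s) + alpha (symbolic_power I u)"
proof -
  obtain f where f: "f \<in> symbolic_power I s" "f \<noteq> 0"
    "\<And>v. v \<in> Poly_Mapping.keys f \<Longrightarrow> mdeg v = alpha (symbolic_power I s)"
    using alpha_symbolic_power_attained[OF I m] by blast
  obtain g where g: "g \<in> symbolic_power I u" "g \<noteq> 0"
    "\<And>v. v \<in> Poly_Mapping.keys g \<Longrightarrow> mdeg v = alpha (symbolic_power I u)"
    using alpha_symbolic_power_attained[OF I m] by blast
  show ?thesis
  proof (rule alpha_le)
    show "f * g \<in> symbolic_power I (s + u)" by (rule symbolic_power_mult[OF I f(1) g(1)])
    show "f * g \<noteq> 0" using f g by simp
    show "mdeg v = alpha (symbolic_power I s) + alpha (symbolic_power I u)"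
      if "v \<in> Poly_Mapping.keys (f * g)" for v
      using that keys_mult[of f g] f(3) g(3) by (auto simp: mdeg_add)
  qed
qed

text \<open>The value of \<open>lim\<close> is the actual limit only once convergence is known,
  which Fekete's lemma gives; the bound then passes to the limit from all
  \<open>s \<ge> 1\<close>.\<close>

lemma waldschmidt_ge:
  fixes I :: "('n::{finite,linorder}, 'k::field) mpoly set"
  assumes I: "ideal I (ring_of TYPE(('n, 'k) mpoly))" and m: "Poly_Mapping.single m 1 \<in> I"
    and bound: "\<And>s. real s * c \<le> real (alpha (symbolic_power I s))"
  shows "c \<le> waldschmidt I"
proof -
  have "real (alpha (symbolic_power I (s + u))) \<le>
      real (alpha (symbolic_power I s)) + real (alpha (symbolic_power I u))" for s u
    using alpha_symbolic_power_add_le[OF I m, of s u] by linarith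
  then have "convergent (\<lambda>s. real (alpha (symbolic_power I s)) / real s)"
    by (intro fekete_convergent) auto
  then have lim: "(\<lambda>s. real (alpha (symbolic_power I s)) / real s) \<longlonglongrightarrow> waldschmidt I"
    unfolding waldschmidt_def by (simp add: convergent_LIMSEQ_iff)
  have "c \<le> real (alpha (symbolic_power I s)) / real s" if "s \<ge> 1" for s
    using bound[of s] that by (simp add: field_simps)
  then show ?thesis by (intro LIMSEQ_le_const[OF lim]) auto
qed

section \<open>Weight bounds on symbolic powers and the final inequality\<close>

text \<open>Elements of \<open>I\<close> have weight at least 1, so those of its \<open>s\<close>-th
  power have weight at least \<open>s\<close>. Localizing at the \<open>j\<close>-th radical only
  allows multipliers of valuation 0, which cancel.\<close>

lemma wdeg_ge_of_symbolic_power: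
  fixes I :: "('n::{finite,linorder}, 'k::field) mpoly set"
  assumes dec: "min_irred_decomp I r A w" and j: "j \<in> {1..r}"
    and f: "f \<in> symbolic_power I s" and u: "u \<in> Poly_Mapping.keys f"
  shows "real s \<le> wdeg (A j) (w j) u"
proof -
  have w: "\<forall>i\<in>A j. 1 \<le> w j i" using dec j by (auto simp: min_irred_decomp_def)
  have I: "ideal I (ring_of TYPE(('n, 'k) mpoly))"
    by (rule min_irred_decomp_ideal[OF dec])
  define V where "V s = {f :: ('n, 'k) mpoly. \<forall>u\<in>Poly_Mapping.keys f. real s \<le> wdeg (A j) (w j) u}" for s
  have "ideal_power I s \<subseteq> V s" for s
  proof (rule ideal_power_subset[OF I])
    show "V 0 = UNIV" by (auto simp: V_def wdeg_nonneg)
    show "I \<subseteq> V 1"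
    proof
      fix f assume f: "f \<in> I"
      have "1 \<le> wdeg (A j) (w j) u" if u: "u \<in> Poly_Mapping.keys f" for u
      proof -
        obtain i where "i \<in> A j" "w j i \<le> Poly_Mapping.lookup u i"
          using f u j unfolding min_irred_decomp_eq[OF dec] by blast
        then show ?thesis using w by (intro one_le_wdeg[of i]) simp_all
      qed
      then show "f \<in> V 1" by (simp add: V_def)
    qed
    show "f + g \<in> V s" if "f \<in> V s" "g \<in> V s" for s f g
      using that Poly_Mapping.keys_add[of f g] by (auto simp: V_def)
    show "f * g \<in> V (s + t)" if "f \<in> V s" "g \<in> V t" for s t f g
      using that keys_mult[of f g] by (force simp: V_def wdeg_add)
  qed
  then have V: "f \<in> V s" if "f \<in> ideal_power I s" for f using that by blast
  obtain b where b: "b \<notin> var_ideal (A j)" "b * f \<in> ideal_power I s"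
    using f var_ideal_in_Ass[OF dec j] unfolding symbolic_power_iff[OF I] by blast
  \<comment> \<open>Outside the prime means having a term free of the variables in
    \<open>A j\<close>, that is, of weight 0.\<close>
  obtain v where v: "v \<in> Poly_Mapping.keys b" "\<forall>i\<in>A j. Poly_Mapping.lookup v i = 0"
    using b(1) by (auto simp: var_ideal_def)
  show ?thesis
  proof (rule weight_cancel_left[OF wdeg_add wdeg_nonneg v(1) _ _ u])
    show "wdeg (A j) (w j) v = 0" using v(2) by (simp add: wdeg_def)
    show "real s \<le> wdeg (A j) (w j) x" if "x \<in> Poly_Mapping.keys (b * f)" for x
      using V[OF b(2)] that by (auto simp: V_def)
  qed
qed

text \<open>Each coefficient \<open>c / w i\<close> is at most 1. This converts weight on a whisker
  into ordinary degree, with \<open>c\<close> the exponent at the attaching vertex, smallest by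
  (i).\<close>

lemma le_of_wdeg:
  fixes A :: "'n::finite set"
  assumes "\<forall>i\<in>A. 1 \<le> w i \<and> c \<le> w i"
  shows "real c * wdeg A w u \<le> (\<Sum>i\<in>A. real (Poly_Mapping.lookup u i))"
  unfolding wdeg_def sum_distrib_left
proof (rule sum_mono)
  fix i assume "i \<in> A"
  then have "0 < real (w i)" "real c \<le> real (w i)" using assms by fastforce+
  then have "real c * real (Poly_Mapping.lookup u i) \<le> real (w i) * real (Poly_Mapping.lookup u i)"
    by (intro mult_right_mono) auto
  then show "real c * (real (Poly_Mapping.lookup u i) / real (w i)) \<le> real (Poly_Mapping.lookup u i)"
    using \<open>0 < real (w i)\<close> by (simp add: divide_le_eq mult.commute)
qed

theorem theorem3p12:
  fixes I :: "('n::{finite,linorder}, 'k::field) mpoly set"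
    and r t h :: nat
    and A :: "nat \<Rightarrow> 'n set"
    and w :: "nat \<Rightarrow> 'n \<Rightarrow> nat"
    and jj :: "nat \<Rightarrow> nat"
    and ii :: "nat \<Rightarrow> 'n"
  assumes "monomial_ideal I" and "I \<noteq> {0}" and "I \<noteq> UNIV"
    and "no_embedded_primes I"
    and "min_irred_decomp I r A w"
    and "\<forall>k\<in>{1..t}. jj k \<in> {1..r}"
    and "whiskered (A ` {1..r}) t (\<lambda>k. A (jj k)) ii"
    and "\<forall>k\<in>{1..t}. \<forall>i\<in>A (jj k). w (jj k) i \<ge> w (jj k) (ii k)"
    and "\<forall>j\<in>{1..r} - jj ` {1..t}. \<exists>k\<in>{1..t}. ii k \<in> A j \<and> w j (ii k) \<le> w (jj k) (ii k)"
    and "big_height I = enat h"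
  shows "waldschmidt I \<ge> (real (alpha I) + real h - 1) / real h"
proof -
  note dec = assms(5)
  have w: "1 \<le> w j i" if "j \<in> {1..r}" "i \<in> A j" for i j
    using dec that by (auto simp: min_irred_decomp_def)
  note I_eq = min_irred_decomp_eq[OF dec]
  have I: "ideal I (ring_of TYPE(('n, 'k) mpoly))"
    by (rule min_irred_decomp_ideal[OF dec])
  have disj: "disjoint_family_on (\<lambda>k. A (jj k)) {1..t}"
    and ii: "\<And>k. k \<in> {1..t} \<Longrightarrow> ii k \<in> A (jj k)"
    using assms(7) by (auto simp: whiskered_def)
  define c where "c k = w (jj k) (ii k)" for k
  \<comment> \<open>The exponent of the product over all whiskers of the attaching variable raised
    to \<open>c k\<close>; its degree bounds \<open>alpha I\<close> from above and the Waldschmidt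
    constant from below.\<close>
  define m where "m = (\<Sum>k\<in>{1..t}. Poly_Mapping.single (ii k) (c k))"
  have mdeg_m: "mdeg m = (\<Sum>k\<in>{1..t}. c k)"
    unfolding m_def mdeg_def lookup_sum
    by (subst sum.swap) (simp add: lookup_single when_def)
  have lookup_m: "c k \<le> Poly_Mapping.lookup m (ii k)" if "k \<in> {1..t}" for k
  proof -
    have "c k = Poly_Mapping.lookup (Poly_Mapping.single (ii k) (c k)) (ii k)" by simp
    also have "\<dots> \<le> Poly_Mapping.lookup m (ii k)"
      unfolding m_def lookup_sum by (rule member_le_sum) (use that in auto)
    finally show ?thesis .
  qed
  have "\<exists>i\<in>A j. w j i \<le> Poly_Mapping.lookup m i" if j: "j \<in> {1..r}" for j
  \<comment> \<open>A whisker component is met at its own attaching vertex, where the threshold is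
    \<open>c k\<close>; any other component is met at the vertex provided by (ii).\<close>
  proof (cases "j \<in> jj ` {1..t}")
    case True
    then obtain k where "k \<in> {1..t}" "j = jj k" by blast
    then show ?thesis using ii[of k] lookup_m[of k] by (intro bexI[of _ "ii k"]) (simp_all add: c_def)
  next
    case False
    then obtain k where k: "k \<in> {1..t}" "ii k \<in> A j" "w j (ii k) \<le> c k"
      using assms(9) j unfolding c_def by blast
    then show ?thesis using lookup_m[OF k(1)] by (intro bexI[of _ "ii k"]) simp_all
  qed
  then have m: "Poly_Mapping.single m 1 \<in> I" by (subst I_eq) auto
  have alpha_le_mdeg: "alpha I \<le> mdeg m" by (rule alpha_le[OF m]) (auto simp flip: keys_eq_empty)

  have alpha_pos: "1 \<le> alpha I"
  proof (rule ccontr)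
    assume "\<not> 1 \<le> alpha I"
    then have 0: "alpha I = 0" by simp
    obtain g where g: "g \<in> I" "g \<noteq> 0" "\<And>u. u \<in> Poly_Mapping.keys g \<Longrightarrow> mdeg u = alpha I"
      by (rule alpha_attained[of I "Poly_Mapping.single m 1" "mdeg m"])
        (use I m in \<open>auto simp: ideal_ring_of_iff simp flip: keys_eq_empty\<close>)
    obtain u where u: "u \<in> Poly_Mapping.keys g" using g(2) by (metis all_not_in_conv keys_eq_empty)
    then have u0: "Poly_Mapping.lookup u i = 0" for i using g(3)[OF u] 0 by (simp add: mdeg_def)
    \<comment> \<open>An empty intersection would be the whole ring. Any component then demands a
      positive exponent, which a term of degree 0 cannot have.\<close>
    have "{1..r} \<noteq> {}" using assms(3) by (subst (asm) I_eq) auto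
    then obtain j where "j \<in> {1..r}" by blast
    moreover from this obtain i where "i \<in> A j" "w j i \<le> Poly_Mapping.lookup u i"
      using g(1) u by (subst (asm) I_eq) blast
    ultimately show False using w[of j i] u0[of i] by simp
  qed

  have "real s * real (mdeg m) \<le> real (alpha (symbolic_power I s))" for s
  proof -
    obtain g where g: "g \<in> symbolic_power I s" "g \<noteq> 0"
      "\<And>u. u \<in> Poly_Mapping.keys g \<Longrightarrow> mdeg u = alpha (symbolic_power I s)"
      using alpha_symbolic_power_attained[OF I m] by blast
    obtain u where u: "u \<in> Poly_Mapping.keys g" using g(2) by (metis all_not_in_conv keys_eq_empty)
    have "real s * real (c k) \<le> (\<Sum>i\<in>A (jj k). real (Poly_Mapping.lookup u i))" if k: "k \<in> {1..t}" for k
    proof -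
      have j: "jj k \<in> {1..r}" using assms(6) k by blast
      have "real (c k) * real s \<le> real (c k) * wdeg (A (jj k)) (w (jj k)) u"
        by (intro mult_left_mono wdeg_ge_of_symbolic_power[OF dec j g(1) u]) simp
      also have "\<dots> \<le> (\<Sum>i\<in>A (jj k). real (Poly_Mapping.lookup u i))"
        by (rule le_of_wdeg) (use w[OF j] assms(8) k in \<open>auto simp: c_def\<close>)
      finally show ?thesis by (simp add: mult.commute)
    qed
    then have "real s * real (mdeg m) \<le>
        (\<Sum>k\<in>{1..t}. \<Sum>i\<in>A (jj k). real (Poly_Mapping.lookup u i))"
      unfolding mdeg_m of_nat_sum sum_distrib_left by (rule sum_mono)
    \<comment> \<open>Disjointness of the whiskers ensures that no variable is counted twice, so the
      contributions add up inside the degree of \<open>u\<close>.\<close>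
    also have "\<dots> = (\<Sum>i\<in>(\<Union>k\<in>{1..t}. A (jj k)). real (Poly_Mapping.lookup u i))"
      by (rule sum.UNION_disjoint[symmetric]) (use disj in \<open>auto simp: disjoint_family_on_def\<close>)
    also have "\<dots> \<le> real (mdeg u)"
      unfolding mdeg_def of_nat_sum by (rule sum_mono2) auto
    finally show ?thesis using g(3)[OF u] by simp
  qed
  then have "real (mdeg m) \<le> waldschmidt I" by (rule waldschmidt_ge[OF I m])
  moreover have "(real (alpha I) + real h - 1) / real h \<le> real (alpha I)"
  \<comment> \<open>For positive \<open>h\<close> the claim is
    \<open>(alpha I - 1) * (h - 1) \<ge> 0\<close> rearranged; for \<open>h = 0\<close> the quotient
    is 0 by the convention on division.\<close>
  proof (cases "h = 0")
    case False
    have "0 \<le> (real (alpha I) - 1) * (real h - 1)"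
      using alpha_pos False by (intro mult_nonneg_nonneg) auto
    then show ?thesis using False by (simp add: field_simps)
  qed simp
  ultimately show ?thesis using alpha_le_mdeg by linarith
qed

end
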